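(* Let $q_1,q_2,\dots,q_k$ be distinct primes and let $j_1,j_2,\dots,j_k$ be positive integers. Then $p=q_1^{j_1}q_2^{j_2}\cdots q_k^{j_k}$ is product-admissible if and only if there exists a nonzero polynomial $\chi\in\mathbb{Z}[z_1,\dots,z_k]$ such that: (i) $\chi(q_1,q_2,\dots,q_k)=0$; (ii) $\chi_\ell(1,1,\dots,1)=0$ for each $1\leq\ell\leq k$, where $\chi_\ell$ denotes the partial derivative of $\chi$ with respect to the $\ell$-th variable $z_\ell$; (iii) for each $1\leq\ell\leq k$, the sum of the absolute values of the coefficients of $\chi_\ell$ is at most $2j_\ell$; (iv) $\chi(1,1,\dots,1)=0$.
   Context: For a multiset $\{x_1,\dots,x_n\}$ of positive integers define $T\{x_1,\dots,x_n\}=(x_1+\cdots+x_n,\,x_1x_2\cdots x_n,\,n)$. An ordered triple $(s,p,n)$ of positive integers is called admissible if there exist at least two different multisets $X$, $Y$ of $n$ positive integers with $T(X)=T(Y)=(s,p,n)$. A positive integer $p$ is product-admissible if there exist positive integers $s$ and $n$ such that $(s,p,n)$ is admissible. *)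

theory Defs
  imports
    "HOL-Library.Multiset"
    "HOL-Library.Poly_Mapping"
    "HOL-Computational_Algebra.Primes"
begin

definition T :: "nat multiset \<Rightarrow> nat \<times> nat \<times> nat" where
  "T X = (sum_mset X, prod_mset X, size X)"

definition admissible :: "nat \<times> nat \<times> nat \<Rightarrow> bool" where
  "admissible = (\<lambda>(s, p, n). s > 0 \<and> p > 0 \<and> n > 0 \<and>
     (\<exists>X Y. X \<noteq> Y \<and> (\<forall>x\<in>#X. x > 0) \<and> (\<forall>y\<in>#Y. y > 0) \<and>
            T X = (s, p, n) \<and> T Y = (s, p, n)))"

definition product_admissible :: "nat \<Rightarrow> bool" where
  "product_admissible p \<longleftrightarrow> p > 0 \<and> (\<exists>s n. s > 0 \<and> n > 0 \<and> admissible (s, p, n))"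

text \<open>
  Polynomials in the variables \<open>z\<^sub>i\<close> (\<open>i :: nat\<close>) are finitely supported maps from exponent
  vectors to coefficients, with the convolution ring structure of \<open>poly_mapping\<close>. The ring
  \<open>\<int>[z\<^sub>1,\<dots>,z\<^sub>k]\<close> consists of the \<open>\<chi> :: int mpoly\<close> with \<open>vars \<chi> \<subseteq> {1..k}\<close>.
\<close>

type_synonym 'a mpoly = "(nat \<Rightarrow>\<^sub>0 nat) \<Rightarrow>\<^sub>0 'a"

definition vars :: "'a::zero mpoly \<Rightarrow> nat set" where
  "vars p = (\<Union>m\<in>Poly_Mapping.keys p. Poly_Mapping.keys m)"

definition eval_mpoly :: "(nat \<Rightarrow> 'a::comm_semiring_1) \<Rightarrow> 'a mpoly \<Rightarrow> 'a" where
  "eval_mpoly a p =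
     (\<Sum>m\<in>Poly_Mapping.keys p.
        Poly_Mapping.lookup p m * (\<Prod>i\<in>Poly_Mapping.keys m. a i ^ Poly_Mapping.lookup m i))"

text \<open>
  Termwise differentiation. If \<open>z\<^sub>l\<close> does not occur in the monomial \<open>m\<close>, the subtraction
  of exponents truncates, but the coefficient of the resulting term is \<open>0\<close>.
\<close>

definition partial_deriv :: "nat \<Rightarrow> 'a::comm_semiring_1 mpoly \<Rightarrow> 'a mpoly" where
  "partial_deriv l p =
     (\<Sum>m\<in>Poly_Mapping.keys p.
        Poly_Mapping.single (m - Poly_Mapping.single l 1)
          (of_nat (Poly_Mapping.lookup m l) * Poly_Mapping.lookup p m))"

definition coeff_abs_sum :: "int mpoly \<Rightarrow> int" where
  "coeff_abs_sum p = (\<Sum>m\<in>Poly_Mapping.keys p. \<bar>Poly_Mapping.lookup p m\<bar>)"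

lemma lookup_partial_deriv:
  "Poly_Mapping.lookup (partial_deriv l p) m =
     of_nat (Poly_Mapping.lookup m l + 1) * Poly_Mapping.lookup p (m + Poly_Mapping.single l 1)"
proof -
  let ?e = "Poly_Mapping.single l (1::nat)"
  let ?t = "\<lambda>m'. of_nat (Poly_Mapping.lookup m' l) * Poly_Mapping.lookup p m'"
  have *: "m' = m + ?e" if "m' - ?e = m" "Poly_Mapping.lookup m' l \<noteq> 0" for m'
  proof (rule poly_mapping_eqI)
    fix i
    show "Poly_Mapping.lookup m' i = Poly_Mapping.lookup (m + ?e) i"
      using that by (auto simp: lookup_add lookup_minus lookup_single when_def)
  qed
  have "Poly_Mapping.lookup (partial_deriv l p) m =
      (\<Sum>m'\<in>Poly_Mapping.keys p. if m' - ?e = m then ?t m' else 0)"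
    by (simp add: partial_deriv_def lookup_sum lookup_single when_def)
  also have "\<dots> = (\<Sum>m'\<in>Poly_Mapping.keys p. if m' = m + ?e then ?t m' else 0)"
    by (intro sum.cong refl) (use * in \<open>fastforce simp: mult_eq_0_iff\<close>)
  also have "\<dots> = ?t (m + ?e)"
    by (auto simp: in_keys_iff)
  finally show ?thesis
    by (simp add: lookup_add)
qed

end

theory Submission
  imports Defs
begin

text \<open>
  Unique factorization identifies a multiset of divisors of \<open>p\<close> with a multiset of monomials
  supported on \<open>{1..k}\<close>, and a pair of multisets \<open>A\<close>, \<open>B\<close> of monomials with the polynomial
  \<open>\<chi>\<close> whose coefficients are the differences of multiplicities. Then (i) says that the two sums
  agree, (iv) that the two sizes agree, and (ii) that the two products agree. In (iii) the sum of
  absolute values is at most the total degree of \<open>A\<close> and \<open>B\<close> in \<open>z\<^sub>l\<close>, with equality if \<open>A\<close> and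
  \<open>B\<close> are disjoint. Conversely, splitting \<open>\<chi>\<close> into its positive and negative part gives two
  multisets with a common product that divides \<open>p\<close>; the missing cofactor is added to both.
\<close>

section \<open>Sums over multisets\<close>

lemma sum_mset_eq_sum_count:
  fixes g :: "'a \<Rightarrow> int"
  assumes "finite S" "set_mset A \<subseteq> S"
  shows "(\<Sum>x\<in>#A. g x) = (\<Sum>x\<in>S. int (count A x) * g x)"
  using assms(2)
proof (induction A)
  case empty
  then show ?case by simp
next
  case (add a A)
  have "(\<Sum>x\<in>S. int (count (add_mset a A) x) * g x)
      = (\<Sum>x\<in>S. int (count A x) * g x + (if x = a then g x else 0))"
    by (intro sum.cong) (auto simp: algebra_simps)
  also have "\<dots> = (\<Sum>x\<in>S. int (count A x) * g x) + g a"
    using add.prems assms(1) by (simp add: sum.distrib)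
  finally show ?case
    using add by simp
qed

lemma sum_mset_of_nat: "(\<Sum>x\<in>#A. of_nat (f x)) = of_nat (\<Sum>x\<in>#A. f x)"
  by (induction A) auto

section \<open>Coefficient sums of partial derivatives\<close>

text \<open>Lowering the exponent of the variable \<open>l\<close> by one is injective on the
  monomials that contain it, so differentiation never merges two terms. The function
  \<open>h\<close> is left general to serve both plain sums, for (ii), and sums of absolute values,
  for (iii).\<close>

lemma partial_deriv_coeff_sum:
  fixes h :: "'a::{comm_semiring_1,semiring_no_zero_divisors,semiring_char_0} \<Rightarrow> 'b::comm_monoid_add"
  assumes "h 0 = 0"
  shows "(\<Sum>m\<in>Poly_Mapping.keys (partial_deriv l p). h (Poly_Mapping.lookup (partial_deriv l p) m))
       = (\<Sum>m\<in>Poly_Mapping.keys p. h (of_nat (Poly_Mapping.lookup m l) * Poly_Mapping.lookup p m))"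
proof -
  let ?e = "Poly_Mapping.single l (1::nat)"
  have restore: "m - ?e + ?e = m" if "Poly_Mapping.lookup m l \<noteq> 0" for m
    using that
    by (intro poly_mapping_eqI) (auto simp: lookup_add lookup_minus lookup_single when_def)
  have "(\<Sum>m\<in>Poly_Mapping.keys (partial_deriv l p). h (Poly_Mapping.lookup (partial_deriv l p) m))
      = (\<Sum>m\<in>{m \<in> Poly_Mapping.keys p. Poly_Mapping.lookup m l \<noteq> 0}.
           h (of_nat (Poly_Mapping.lookup m l) * Poly_Mapping.lookup p m))"
  proof (rule sum.reindex_bij_witness[where i = "\<lambda>m. m - ?e" and j = "\<lambda>m. m + ?e"])
    fix m assume "m \<in> Poly_Mapping.keys (partial_deriv l p)"
    then have "Poly_Mapping.lookup p (m + ?e) \<noteq> 0"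
      by (auto simp: in_keys_iff lookup_partial_deriv)
    then show "m + ?e \<in> {m \<in> Poly_Mapping.keys p. Poly_Mapping.lookup m l \<noteq> 0}"
      by (simp add: in_keys_iff lookup_add)
  next
    fix m assume "m \<in> {m \<in> Poly_Mapping.keys p. Poly_Mapping.lookup m l \<noteq> 0}"
    then have *: "Poly_Mapping.lookup p m \<noteq> 0" "Poly_Mapping.lookup m l \<noteq> 0"
      by (auto simp: in_keys_iff)
    show "m - ?e + ?e = m"
      using * by (intro restore)
    \<comment> \<open>Characteristic zero enters here: the exponent brought down as a factor cannot
      vanish, so no term that contains the variable is lost.\<close>
    have "of_nat (Poly_Mapping.lookup (m - ?e) l + 1) \<noteq> (0::'a)"
      by (simp only: of_nat_eq_0_iff)
    then show "m - ?e \<in> Poly_Mapping.keys (partial_deriv l p)"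
      using * unfolding in_keys_iff lookup_partial_deriv restore[OF *(2)]
      by (metis mult_eq_0_iff)
  qed (simp_all add: lookup_partial_deriv lookup_add)
  \<comment> \<open>A monomial without the variable has factor 0 and contributes
    \<open>h 0 = 0\<close>.\<close>
  also have "\<dots> = (\<Sum>m\<in>Poly_Mapping.keys p.
      h (of_nat (Poly_Mapping.lookup m l) * Poly_Mapping.lookup p m))"
    by (rule sum.mono_neutral_left) (auto simp: assms)
  finally show ?thesis .
qed

lemma eval_mpoly_ones: "eval_mpoly (\<lambda>i. 1) p = (\<Sum>m\<in>Poly_Mapping.keys p. Poly_Mapping.lookup p m)"
  by (simp add: eval_mpoly_def)

lemma eval_ones_partial_deriv:
  fixes p :: "int mpoly"
  shows "eval_mpoly (\<lambda>i. 1) (partial_deriv l p)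
       = (\<Sum>m\<in>Poly_Mapping.keys p. Poly_Mapping.lookup p m * int (Poly_Mapping.lookup m l))"
  using partial_deriv_coeff_sum[of "\<lambda>x. x" l p] by (simp add: eval_mpoly_ones mult.commute)

lemma coeff_abs_sum_partial_deriv:
  "coeff_abs_sum (partial_deriv l p)
     = (\<Sum>m\<in>Poly_Mapping.keys p. \<bar>Poly_Mapping.lookup p m\<bar> * int (Poly_Mapping.lookup m l))"
  using partial_deriv_coeff_sum[of abs l p] by (simp add: coeff_abs_sum_def abs_mult mult.commute)

section \<open>Polynomials as differences of multisets of monomials\<close>

text \<open>Elements common to \<open>A\<close> and \<open>B\<close> cancel, so the pair cannot be
  recovered from the result unless it is known to be disjoint.\<close>

definition count_diff :: "'a multiset \<Rightarrow> 'a multiset \<Rightarrow> 'a \<Rightarrow>\<^sub>0 int" where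
  "count_diff A B = Abs_poly_mapping (\<lambda>m. int (count A m) - int (count B m))"

lemma lookup_count_diff:
  "Poly_Mapping.lookup (count_diff A B) m = int (count A m) - int (count B m)"
proof -
  have "finite {m. int (count A m) - int (count B m) \<noteq> 0}"
    by (rule finite_subset[of _ "set_mset A \<union> set_mset B"]) (auto simp flip: count_greater_zero_iff)
  then show ?thesis
    by (simp add: count_diff_def)
qed

lemma keys_count_diff: "Poly_Mapping.keys (count_diff A B) \<subseteq> set_mset A \<union> set_mset B"
  by (auto simp: in_keys_iff lookup_count_diff simp flip: count_greater_zero_iff)

lemma count_diff_nonzero_iff: "count_diff A B \<noteq> 0 \<longleftrightarrow> A \<noteq> B"
  by (auto simp: poly_mapping_eq_iff lookup_count_diff multiset_eq_iff fun_eq_iff)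

text \<open>This translates every condition that is linear in the coefficients: the weight
  \<open>g\<close> is the value of the monomial at the primes for (i), its degree in one variable
  for (ii), and 1 for (iv).\<close>

lemma sum_count_diff:
  "(\<Sum>m\<in>Poly_Mapping.keys (count_diff A B). Poly_Mapping.lookup (count_diff A B) m * g m)
     = (\<Sum>m\<in>#A. g m) - (\<Sum>m\<in>#B. g m)"
proof -
  let ?S = "set_mset A \<union> set_mset B"
  have "(\<Sum>m\<in>Poly_Mapping.keys (count_diff A B). Poly_Mapping.lookup (count_diff A B) m * g m)
      = (\<Sum>m\<in>?S. Poly_Mapping.lookup (count_diff A B) m * g m)"
    using keys_count_diff[of A B] by (intro sum.mono_neutral_left) (auto simp: not_in_keys_iff_lookup_eq_zero)
  also have "\<dots> = (\<Sum>m\<in>?S. int (count A m) * g m) - (\<Sum>m\<in>?S. int (count B m) * g m)"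
    by (simp add: lookup_count_diff left_diff_distrib sum_subtractf)
  finally show ?thesis
    by (simp add: sum_mset_eq_sum_count[of ?S])
qed

lemma sum_abs_count_diff:
  "(\<Sum>m\<in>Poly_Mapping.keys (count_diff A B). \<bar>Poly_Mapping.lookup (count_diff A B) m\<bar> * g m)
     = (\<Sum>m\<in>set_mset A \<union> set_mset B. \<bar>int (count A m) - int (count B m)\<bar> * g m)"
  unfolding lookup_count_diff[symmetric]
  using keys_count_diff[of A B] by (intro sum.mono_neutral_left) (auto simp: not_in_keys_iff_lookup_eq_zero)

text \<open>The triangle inequality for each multiplicity, weighted by the nonnegative
  \<open>g\<close>.\<close>

lemma sum_abs_count_diff_le:
  assumes "\<And>m. 0 \<le> g m"
  shows "(\<Sum>m\<in>Poly_Mapping.keys (count_diff A B). \<bar>Poly_Mapping.lookup (count_diff A B) m\<bar> * g m)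
     \<le> (\<Sum>m\<in>#A. g m) + (\<Sum>m\<in>#B. g m)"
proof -
  let ?S = "set_mset A \<union> set_mset B"
  have "(\<Sum>m\<in>?S. \<bar>int (count A m) - int (count B m)\<bar> * g m)
      \<le> (\<Sum>m\<in>?S. int (count A m) * g m + int (count B m) * g m)"
    unfolding distrib_right[symmetric] by (intro sum_mono mult_right_mono assms) auto
  then show ?thesis
    by (simp add: sum_abs_count_diff sum.distrib sum_mset_eq_sum_count[of ?S])
qed

text \<open>At each monomial one of the two multiplicities is 0, so nothing cancels and the triangle
  inequality becomes an equality.\<close>

lemma sum_abs_count_diff_disjoint:
  assumes "A \<inter># B = {#}"
  shows "(\<Sum>m\<in>Poly_Mapping.keys (count_diff A B). \<bar>Poly_Mapping.lookup (count_diff A B) m\<bar> * g m)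
     = (\<Sum>m\<in>#A. g m) + (\<Sum>m\<in>#B. g m)"
proof -
  let ?S = "set_mset A \<union> set_mset B"
  have "count A m = 0 \<or> count B m = 0" for m
    using assms by (metis count_empty count_inter_mset min_def)
  then have "\<bar>int (count A m) - int (count B m)\<bar> = int (count A m) + int (count B m)" for m
    by (metis abs_of_nat abs_minus_cancel add.right_neutral add_0 diff_0 diff_0_right of_nat_0)
  then show ?thesis
    by (simp add: sum_abs_count_diff distrib_right sum.distrib sum_mset_eq_sum_count[of ?S])
qed

lemma count_diff_decomposition:
  fixes \<chi> :: "'a \<Rightarrow>\<^sub>0 int"
  obtains A B where "A \<inter># B = {#}" "\<chi> = count_diff A B"
    "set_mset A \<union> set_mset B \<subseteq> Poly_Mapping.keys \<chi>"
proof -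
  \<comment> \<open>Since \<open>nat\<close> sends negative integers to 0, \<open>A\<close> collects
    the positive coefficients and \<open>B\<close> the negative ones.\<close>
  define A B where "A = Abs_multiset (\<lambda>m. nat (Poly_Mapping.lookup \<chi> m))"
    and "B = Abs_multiset (\<lambda>m. nat (- Poly_Mapping.lookup \<chi> m))"
  have A: "count A m = nat (Poly_Mapping.lookup \<chi> m)" for m
    unfolding A_def
    by (subst count_Abs_multiset) (auto simp: in_keys_iff intro: finite_subset[of _ "Poly_Mapping.keys \<chi>"])
  have B: "count B m = nat (- Poly_Mapping.lookup \<chi> m)" for m
    unfolding B_def
    by (subst count_Abs_multiset) (auto simp: in_keys_iff intro: finite_subset[of _ "Poly_Mapping.keys \<chi>"])
  show thesis
  proof
    show "A \<inter># B = {#}"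
      by (rule multiset_eqI) (simp add: A B)
    show "\<chi> = count_diff A B"
      by (rule poly_mapping_eqI) (simp add: lookup_count_diff A B)
    show "set_mset A \<union> set_mset B \<subseteq> Poly_Mapping.keys \<chi>"
      by (auto simp: A B in_keys_iff simp flip: count_greater_zero_iff)
  qed
qed

section \<open>Monomials and divisors\<close>

text \<open>The product runs over the fixed range \<open>{1..k}\<close> rather than over the keys of
  \<open>m\<close>, so that the values of several monomials multiply factor by factor.\<close>

definition prime_monomial :: "nat \<Rightarrow> (nat \<Rightarrow> nat) \<Rightarrow> (nat \<Rightarrow>\<^sub>0 nat) \<Rightarrow> nat" where
  "prime_monomial k q m = (\<Prod>i=1..k. q i ^ Poly_Mapping.lookup m i)"

text \<open>The intended inverse of \<open>prime_monomial\<close>. Cutting off outside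
  \<open>{1..k}\<close> ensures finite support, whatever \<open>q\<close> does there.\<close>

definition exponents :: "nat \<Rightarrow> (nat \<Rightarrow> nat) \<Rightarrow> nat \<Rightarrow> nat \<Rightarrow>\<^sub>0 nat" where
  "exponents k q x = Abs_poly_mapping (\<lambda>i. multiplicity (q i) x when i \<in> {1..k})"

lemma lookup_exponents:
  "Poly_Mapping.lookup (exponents k q x) i = (multiplicity (q i) x when i \<in> {1..k})"
proof -
  have "finite {i. (multiplicity (q i) x when i \<in> {1..k}) \<noteq> 0}"
    by (rule finite_subset[of _ "{1..k}"]) (auto simp: when_def split: if_splits)
  then show ?thesis
    by (simp add: exponents_def)
qed

lemma keys_exponents: "Poly_Mapping.keys (exponents k q x) \<subseteq> {1..k}"
  by (auto simp: in_keys_iff lookup_exponents when_def split: if_splits)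

lemma eval_mpoly_prime_monomial:
  assumes "vars \<chi> \<subseteq> {1..k}"
  shows "eval_mpoly (\<lambda>i. int (q i)) \<chi>
       = (\<Sum>m\<in>Poly_Mapping.keys \<chi>. Poly_Mapping.lookup \<chi> m * int (prime_monomial k q m))"
  unfolding eval_mpoly_def
proof (rule sum.cong[OF refl])
  fix m assume "m \<in> Poly_Mapping.keys \<chi>"
  then have "Poly_Mapping.keys m \<subseteq> {1..k}"
    using assms by (auto simp: vars_def)
  then have "(\<Prod>i\<in>Poly_Mapping.keys m. int (q i) ^ Poly_Mapping.lookup m i)
      = (\<Prod>i=1..k. int (q i) ^ Poly_Mapping.lookup m i)"
    by (intro prod.mono_neutral_left) (auto simp: in_keys_iff)
  then show "Poly_Mapping.lookup \<chi> m * (\<Prod>i\<in>Poly_Mapping.keys m. int (q i) ^ Poly_Mapping.lookup m i)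
      = Poly_Mapping.lookup \<chi> m * int (prime_monomial k q m)"
    by (simp add: prime_monomial_def)
qed

lemma prod_prime_monomial:
  "(\<Prod>m\<in>#A. prime_monomial k q m) = (\<Prod>i=1..k. q i ^ (\<Sum>m\<in>#A. Poly_Mapping.lookup m i))"
  by (induction A) (simp_all add: prime_monomial_def power_add prod.distrib)

lemma multiplicity_prod_distinct_primes:
  fixes q :: "'b \<Rightarrow> nat"
  assumes "finite I" "\<forall>i\<in>I. prime (q i)" "inj_on q I" "l \<in> I"
  shows "multiplicity (q l) (\<Prod>i\<in>I. q i ^ e i) = e l"
proof -
  have "multiplicity (q l) (\<Prod>i\<in>I. q i ^ e i) = (\<Sum>i\<in>I. multiplicity (q l) (q i ^ e i))"
    using assms by (intro prime_elem_multiplicity_prod_distrib) auto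
  also have "\<dots> = (\<Sum>i\<in>I. if i = l then e l else 0)"
  proof (rule sum.cong[OF refl])
    fix i assume "i \<in> I"
    then show "multiplicity (q l) (q i ^ e i) = (if i = l then e l else 0)"
      using assms multiplicity_distinct_prime_power[of "q l" "q i" "e i"]
      by (auto simp: inj_on_eq_iff)
  qed
  finally show ?thesis
    using assms by simp
qed

lemma exponents_prime_monomial:
  assumes "\<forall>i\<in>{1..k}. prime (q i)" "inj_on q {1..k}" "Poly_Mapping.keys m \<subseteq> {1..k}"
  shows "exponents k q (prime_monomial k q m) = m"
proof (rule poly_mapping_eqI)
  fix i
  show "Poly_Mapping.lookup (exponents k q (prime_monomial k q m)) i = Poly_Mapping.lookup m i"
    using assms multiplicity_prod_distinct_primes[OF _ assms(1,2)]
    by (auto simp: lookup_exponents prime_monomial_def when_def in_keys_iff)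
qed

text \<open>Both sides have the same multiplicity at every prime: at each \<open>q i\<close> by
  construction, and at any other prime both multiplicities are 0, because \<open>x\<close> divides a
  product of powers of the \<open>q i\<close>.\<close>

lemma prime_monomial_exponents:
  assumes "\<forall>i\<in>{1..k}. prime (q i)" "inj_on q {1..k}"
    and "x dvd (\<Prod>i=1..k. q i ^ j i)"
  shows "prime_monomial k q (exponents k q x) = x"
proof (rule multiplicity_eq_nat)
  let ?p = "\<Prod>i=1..k. q i ^ j i"
  have "?p > 0"
    using assms(1) by (intro prod_pos) (auto simp: prime_gt_0_nat)
  then show "x > 0"
    using assms(3) by (rule dvd_pos_nat)
  show "prime_monomial k q (exponents k q x) > 0"
    unfolding prime_monomial_def using assms(1) by (intro prod_pos) (auto simp: prime_gt_0_nat)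
  fix r :: nat assume r: "prime r"
  show "multiplicity r (prime_monomial k q (exponents k q x)) = multiplicity r x"
  proof (cases "r \<in> q ` {1..k}")
    case True
    then show ?thesis
      using multiplicity_prod_distinct_primes[OF _ assms(1,2)]
      by (auto simp: prime_monomial_def lookup_exponents when_def)
  next
    case False
    \<comment> \<open>Arbitrary exponents \<open>e\<close> cover both \<open>?p\<close> and the
      reconstructed number.\<close>
    have *: "multiplicity r (\<Prod>i=1..k. q i ^ e i) = 0" for e
    proof (rule not_dvd_imp_multiplicity_0, rule notI)
      assume "r dvd (\<Prod>i=1..k. q i ^ e i)"
      then obtain i where "i \<in> {1..k}" "r dvd q i ^ e i"
        using r by (auto simp: prime_dvd_prod_iff)
      then have "r = q i"
        using r assms(1) by (metis prime_dvd_power primes_dvd_imp_eq)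
      then show False
        using False \<open>i \<in> {1..k}\<close> by blast
    qed
    have "multiplicity r x \<le> multiplicity r ?p"
      using assms(3) \<open>?p > 0\<close> by (intro dvd_imp_multiplicity_le) auto
    then show ?thesis
      using * by (simp add: prime_monomial_def)
  qed
qed

lemma multiplicity_prod_mset:
  fixes X :: "nat multiset"
  assumes "prime r" "\<forall>x\<in>#X. x > 0"
  shows "(\<Sum>x\<in>#X. multiplicity r x) = multiplicity r (\<Prod>\<^sub># X)"
  using assms(2)
proof (induction X)
  case (add x X)
  then have "\<Prod>\<^sub># X \<noteq> 0" by (auto simp: prod_mset_zero_iff)
  then show ?case
    using add assms(1) by (simp add: prime_elem_multiplicity_mult_distrib)
qed simp

section \<open>From admissibility to a polynomial\<close>

lemma product_admissible_imp_polynomial: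
  fixes q j :: "nat \<Rightarrow> nat"
  assumes q: "\<forall>i\<in>{1..k}. prime (q i)" "inj_on q {1..k}"
    and adm: "product_admissible (\<Prod>i=1..k. q i ^ j i)"
  shows "\<exists>\<chi> :: int mpoly. \<chi> \<noteq> 0 \<and> vars \<chi> \<subseteq> {1..k} \<and>
       eval_mpoly (\<lambda>i. int (q i)) \<chi> = 0 \<and>
       (\<forall>l\<in>{1..k}. eval_mpoly (\<lambda>i. 1) (partial_deriv l \<chi>) = 0) \<and>
       (\<forall>l\<in>{1..k}. coeff_abs_sum (partial_deriv l \<chi>) \<le> 2 * int (j l)) \<and>
       eval_mpoly (\<lambda>i. 1) \<chi> = 0"
proof -
  let ?p = "\<Prod>i=1..k. q i ^ j i"
  from adm obtain X Y where XY: "X \<noteq> Y" "\<forall>x\<in>#X. x > 0" "\<forall>y\<in>#Y. y > 0"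
    "\<Sum>\<^sub># X = \<Sum>\<^sub># Y" "\<Prod>\<^sub># X = ?p" "\<Prod>\<^sub># Y = ?p" "size X = size Y"
    by (auto simp: product_admissible_def admissible_def T_def)
  define A B where "A = image_mset (exponents k q) X" and "B = image_mset (exponents k q) Y"
  have inverse: "image_mset (prime_monomial k q) (image_mset (exponents k q) Z) = Z"
    if "\<Prod>\<^sub># Z = ?p" for Z
  proof -
    have "prime_monomial k q (exponents k q x) = x" if "x \<in># Z" for x
      using prime_monomial_exponents[OF q] dvd_prod_mset[OF that] \<open>\<Prod>\<^sub># Z = ?p\<close> by simp
    then show ?thesis
      by (simp add: image_mset.compositionality o_def cong: image_mset_cong)
  qed
  \<comment> \<open>The total degree in the variable \<open>l\<close> is the multiplicity of
    \<open>q l\<close> in the product of \<open>Z\<close>. It is therefore the same for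
    \<open>A\<close> and \<open>B\<close>, which gives (ii), and twice this value bounds the sum in
    (iii).\<close>
  have degree: "(\<Sum>m\<in>#image_mset (exponents k q) Z. int (Poly_Mapping.lookup m l)) = int (j l)"
    if "\<Prod>\<^sub># Z = ?p" "\<forall>x\<in>#Z. x > 0" "l \<in> {1..k}" for Z l
    using multiplicity_prod_mset[of "q l" Z] multiplicity_prod_distinct_primes[OF _ q] q that
    by (simp add: image_mset.compositionality o_def lookup_exponents sum_mset_of_nat)
  let ?\<chi> = "count_diff A B"
  \<comment> \<open>By \<open>inverse\<close>, \<open>A = B\<close> would force
    \<open>X = Y\<close>.\<close>
  have "?\<chi> \<noteq> 0"
    using inverse XY unfolding count_diff_nonzero_iff A_def B_def by metis
  moreover have vars: "vars ?\<chi> \<subseteq> {1..k}"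
    using keys_count_diff[of A B] keys_exponents unfolding vars_def A_def B_def by fastforce
  moreover have "eval_mpoly (\<lambda>i. int (q i)) ?\<chi> = 0"
    unfolding eval_mpoly_prime_monomial[OF vars] sum_count_diff sum_mset_of_nat
    using XY inverse by (simp add: A_def B_def)
  moreover have "\<forall>l\<in>{1..k}. eval_mpoly (\<lambda>i. 1) (partial_deriv l ?\<chi>) = 0"
    unfolding eval_ones_partial_deriv sum_count_diff A_def B_def
    using degree XY by auto
  moreover have "coeff_abs_sum (partial_deriv l ?\<chi>) \<le> 2 * int (j l)" if "l \<in> {1..k}" for l
  proof -
    \<comment> \<open>\<open>X\<close> and \<open>Y\<close> may share elements, so only an
      inequality is available here.\<close>
    have "coeff_abs_sum (partial_deriv l ?\<chi>)
        \<le> (\<Sum>m\<in>#A. int (Poly_Mapping.lookup m l)) + (\<Sum>m\<in>#B. int (Poly_Mapping.lookup m l))"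
      unfolding coeff_abs_sum_partial_deriv by (rule sum_abs_count_diff_le) simp
    then show ?thesis
      using degree that XY unfolding A_def B_def by simp
  qed
  moreover have "eval_mpoly (\<lambda>i. 1) ?\<chi> = 0"
    using sum_count_diff[of A B "\<lambda>_. 1"] XY by (simp add: eval_mpoly_ones A_def B_def)
  ultimately show ?thesis
    by blast
qed

section \<open>From a polynomial to admissibility\<close>

lemma polynomial_imp_product_admissible:
  fixes q j :: "nat \<Rightarrow> nat" and \<chi> :: "int mpoly"
  assumes q: "\<forall>i\<in>{1..k}. prime (q i)" "inj_on q {1..k}"
    and "\<chi> \<noteq> 0" and vars: "vars \<chi> \<subseteq> {1..k}"
    and i: "eval_mpoly (\<lambda>i. int (q i)) \<chi> = 0"
    and ii: "\<forall>l\<in>{1..k}. eval_mpoly (\<lambda>i. 1) (partial_deriv l \<chi>) = 0"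
    and iii: "\<forall>l\<in>{1..k}. coeff_abs_sum (partial_deriv l \<chi>) \<le> 2 * int (j l)"
    and iv: "eval_mpoly (\<lambda>i. 1) \<chi> = 0"
  shows "product_admissible (\<Prod>i=1..k. q i ^ j i)"
proof -
  let ?p = "\<Prod>i=1..k. q i ^ j i"
  obtain A B where AB: "A \<inter># B = {#}" "\<chi> = count_diff A B"
    and "set_mset A \<union> set_mset B \<subseteq> Poly_Mapping.keys \<chi>"
    by (rule count_diff_decomposition)
  then have keys: "\<forall>m \<in> set_mset A \<union> set_mset B. Poly_Mapping.keys m \<subseteq> {1..k}"
    using vars by (auto simp: vars_def)
  let ?M = "prime_monomial k q"
  let ?d = "\<lambda>l A. \<Sum>m\<in>#A. Poly_Mapping.lookup m l"
  have pos: "?M m > 0" for m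
    unfolding prime_monomial_def using q by (intro prod_pos) (auto simp: prime_gt_0_nat)
  have sums: "(\<Sum>m\<in>#A. ?M m) = (\<Sum>m\<in>#B. ?M m)"
    using i unfolding eval_mpoly_prime_monomial[OF vars] unfolding AB(2) sum_count_diff sum_mset_of_nat
    by (simp only: right_minus_eq of_nat_eq_iff)
  have sizes: "size A = size B"
    using iv sum_count_diff[of A B "\<lambda>_. 1"] by (simp add: eval_mpoly_ones AB(2))
  have deg_eq: "?d l A = ?d l B" if "l \<in> {1..k}" for l
    using bspec[OF ii that]
    unfolding eval_ones_partial_deriv AB(2) sum_count_diff sum_mset_of_nat
    by (simp only: right_minus_eq of_nat_eq_iff)
  \<comment> \<open>By disjointness the sum in (iii) is exactly \<open>?d l A + ?d l B\<close>,
    which is twice \<open>?d l A\<close> by \<open>deg_eq\<close>; halving gives the bound.\<close>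
  have deg_le: "?d l A \<le> j l" if "l \<in> {1..k}" for l
    using bspec[OF iii that] deg_eq[OF that]
    unfolding coeff_abs_sum_partial_deriv AB(2) sum_abs_count_diff_disjoint[OF AB(1)] sum_mset_of_nat
    by linarith
  \<comment> \<open>The cofactor that completes the common product to \<open>?p\<close>. By
    \<open>deg_le\<close> the subtraction of exponents does not truncate.\<close>
  define r where "r = (\<Prod>l=1..k. q l ^ (j l - ?d l A))"
  have r: "r > 0"
    unfolding r_def using q by (intro prod_pos) (auto simp: prime_gt_0_nat)
  have prod_A: "r * (\<Prod>m\<in>#A. ?M m) = ?p"
    unfolding r_def prod_prime_monomial prod.distrib[symmetric] power_add[symmetric]
    using deg_le by (intro prod.cong) auto
  have "(\<Prod>m\<in>#A. ?M m) = (\<Prod>m\<in>#B. ?M m)"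
    unfolding prod_prime_monomial using deg_eq by (intro prod.cong) auto
  with prod_A have prod_B: "r * (\<Prod>m\<in>#B. ?M m) = ?p"
    by simp
  have inverse: "image_mset (exponents k q) (image_mset ?M C) = C"
    if "\<forall>m\<in>#C. Poly_Mapping.keys m \<subseteq> {1..k}" for C
    using exponents_prime_monomial[OF q] that
    by (simp add: image_mset.compositionality o_def cong: image_mset_cong)
  have "A \<noteq> B"
    using \<open>\<chi> \<noteq> 0\<close> AB(2) count_diff_nonzero_iff by blast
  \<comment> \<open>The common element \<open>r\<close> cancels, and \<open>exponents\<close>
    recovers \<open>A\<close> and \<open>B\<close> from their images.\<close>
  then have XY: "add_mset r (image_mset ?M A) \<noteq> add_mset r (image_mset ?M B)"
    using inverse[of A] inverse[of B] keys by auto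
  \<comment> \<open>The summand \<open>r\<close> and the successor account for the added
    cofactor.\<close>
  let ?s = "r + (\<Sum>m\<in>#A. ?M m)" and ?n = "Suc (size A)"
  have p: "?p > 0"
    using q by (intro prod_pos) (auto simp: prime_gt_0_nat)
  have T: "T (add_mset r (image_mset ?M A)) = (?s, ?p, ?n)"
    "T (add_mset r (image_mset ?M B)) = (?s, ?p, ?n)"
    using prod_A prod_B sums sizes by (simp_all add: T_def)
  have "admissible (?s, ?p, ?n)"
    unfolding admissible_def split
    by (intro conjI exI[of _ "add_mset r (image_mset ?M A)"] exI[of _ "add_mset r (image_mset ?M B)"] XY T)
      (use p pos r in auto)
  then show ?thesis
    using p r unfolding product_admissible_def by (intro conjI exI[of _ ?s] exI[of _ ?n]) auto
qed

theorem theorem3p1: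
  fixes k p :: nat and q j :: "nat \<Rightarrow> nat"
  assumes "\<forall>i\<in>{1..k}. prime (q i)"
    and "inj_on q {1..k}"
    and "\<forall>i\<in>{1..k}. j i > 0"
    and "p = (\<Prod>i=1..k. q i ^ j i)"
  shows "product_admissible p \<longleftrightarrow>
    (\<exists>\<chi> :: int mpoly. \<chi> \<noteq> 0 \<and> vars \<chi> \<subseteq> {1..k} \<and>
       eval_mpoly (\<lambda>i. int (q i)) \<chi> = 0 \<and>
       (\<forall>l\<in>{1..k}. eval_mpoly (\<lambda>i. 1) (partial_deriv l \<chi>) = 0) \<and>
       (\<forall>l\<in>{1..k}. coeff_abs_sum (partial_deriv l \<chi>) \<le> 2 * int (j l)) \<and>
       eval_mpoly (\<lambda>i. 1) \<chi> = 0)"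
  using product_admissible_imp_polynomial[OF assms(1,2), of j]
    polynomial_imp_product_admissible[OF assms(1,2), of _ j]
  unfolding assms(4) by blast

end
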